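(* Let $\mathcal{N}=\langle S,A,\iota,\{p_i\}_{i\in I}\rangle$ be a MEMDP and $T\subseteq S$. There exists a policy $\sigma$ with $\Pr_{\mathcal{N}_i}(T\mid\sigma)=1$ for all $i\in I$ if and only if there exists an observation-based policy on the belief-observation MDP $\mathcal{G}_{\mathcal{N}}$ that reaches the state set $T_{\mathcal{G}}$ with probability $1$ from the initial distribution of $\mathcal{G}_{\mathcal{N}}$.
   Context: An MDP is $\langle S,A,\iota,p\rangle$ with finite $S$, $A$, initial distribution $\iota$, and total $p\colon S\times A\to\mathit{Dist}(S)$. A MEMDP $\mathcal{N}=\langle S,A,\iota,\{p_i\}_{i\in I}\rangle$ has a finite set $I$ of environments, each $p_i\colon S\times A\to\mathit{Dist}(S)$, and $\mathcal{N}_i=\langle S,A,\iota,p_i\rangle$. A policy maps finite histories $s_0a_0\dots s_n$ to distributions over $A$; $\Pr_{\mathcal{N}_i}(T\mid\sigma)$ is the probability of eventually reaching $T$ in $\mathcal{N}_i$ under $\sigma$ from $\iota$. For $J\subseteq I$, $s,s'\in S$, $a\in A$ let $\mathsf{Up}(J,s,a,s')=\{i\in J: p_i(s,a)(s')>0\}$. The belief-observation MDP $\mathcal{G}_{\mathcal{N}}$ is the MDP with states $S\times I\times 2^I$, actions $A$, initial distribution $\iota'(\langle s,j,I\rangle)=\iota(s)/|I|$ (and $0$ on states whose third component is not $I$), and transitions $p'(\langle s,j,J\rangle,a)(\langle s',j,J'\rangle)=p_j(s,a)(s')$ if $J'=\mathsf{Up}(J,s,a,s')$ and $0$ otherwise,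 equipped with observations $Z=S\times 2^I$ and observation function $O(\langle s,j,J\rangle)=\langle s,J\rangle$. $O$ is lifted to histories by $O(x_0a_0x_1\dots x_n)=O(x_0)a_0O(x_1)\dots O(x_n)$; a policy $\sigma$ on $\mathcal{G}_{\mathcal{N}}$ is observation-based if $O(\pi)=O(\pi')$ implies $\sigma(\pi)=\sigma(\pi')$. The lifted target set is $T_{\mathcal{G}}=\{\langle s,j,J\rangle: s\in T,\ J\subseteq I,\ j\in J\}$. *)

theory Defs
  imports "HOL-Probability.Probability"
begin

text \<open>
  The finite sets of states, actions and environments are the universes of types of class
  \<open>finite\<close>, and \<open>Dist(X)\<close> is \<open>'x pmf\<close>; every value of the record types below is a
  legitimate model.
\<close>

record ('s::finite, 'a::finite) mdp =
  init :: "'s pmf"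
  step :: "'s \<Rightarrow> 'a \<Rightarrow> 's pmf"

record ('s::finite, 'a::finite, 'i::finite) memdp =
  me_init :: "'s pmf"
  me_step :: "'i \<Rightarrow> 's \<Rightarrow> 'a \<Rightarrow> 's pmf"

record ('s::finite, 'a::finite, 'z) obs_mdp = "('s, 'a) mdp" +
  obs :: "'s \<Rightarrow> 'z"

definition env :: "('s::finite, 'a::finite, 'i::finite) memdp \<Rightarrow> 'i \<Rightarrow> ('s, 'a) mdp" where
  "env N i = \<lparr>init = me_init N, step = me_step N i\<rparr>"

text \<open>
  The history \<open>s\<^sub>0a\<^sub>0s\<^sub>1 \<dots> a\<^bsub>n-1\<^esub>s\<^sub>n\<close> is
  \<open>([(s\<^sub>0, a\<^sub>0), \<dots>, (s\<^bsub>n-1\<^esub>, a\<^bsub>n-1\<^esub>)], s\<^sub>n)\<close>.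
\<close>

type_synonym ('s, 'a) history = "('s \<times> 'a) list \<times> 's"

type_synonym ('s, 'a) policy = "('s, 'a) history \<Rightarrow> 'a pmf"

text \<open>
  A run \<open>s\<^sub>0a\<^sub>0s\<^sub>1a\<^sub>1 \<dots>\<close> is \<open>\<omega>\<close> with \<open>\<omega> n = (s\<^sub>n, a\<^sub>n)\<close>. Given the first \<open>n\<close> pairs of a run,
  \<open>next_pair M \<sigma> n \<omega>\<close> is the law of the pair number \<open>n\<close>; it depends on \<open>\<omega>\<close> only below \<open>n\<close>.
\<close>

definition next_state ::
  "('s::finite, 'a::finite, 'm) mdp_scheme \<Rightarrow> nat \<Rightarrow> (nat \<Rightarrow> 's \<times> 'a) \<Rightarrow> 's pmf" where
  "next_state M n \<omega> = (case n of 0 \<Rightarrow> init M | Suc m \<Rightarrow> step M (fst (\<omega> m)) (snd (\<omega> m)))"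

definition next_pair ::
  "('s::finite, 'a::finite, 'm) mdp_scheme \<Rightarrow> ('s, 'a) policy \<Rightarrow> nat \<Rightarrow> (nat \<Rightarrow> 's \<times> 'a) \<Rightarrow> ('s \<times> 'a) pmf"
  where
  "next_pair M \<sigma> n \<omega> =
     bind_pmf (next_state M n \<omega>) (\<lambda>s. map_pmf (Pair s) (\<sigma> (map \<omega> [0..<n], s)))"

text \<open>
  The measure on runs is the one that the Ionescu-Tulcea theorem yields for these kernels, as a
  measure on the product sigma-algebra over the discrete spaces of pairs.
\<close>

definition run_measure ::
  "('s::finite, 'a::finite, 'm) mdp_scheme \<Rightarrow> ('s, 'a) policy \<Rightarrow> (nat \<Rightarrow> 's \<times> 'a) measure" where
  "run_measure M \<sigma> =
     projective_family.lim UNIV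
       (Ionescu_Tulcea.CI (\<lambda>n \<omega>. measure_pmf (next_pair M \<sigma> n \<omega>)) (\<lambda>_. count_space UNIV))
       (\<lambda>_. count_space UNIV)"

definition reach_prob ::
  "('s::finite, 'a::finite, 'm) mdp_scheme \<Rightarrow> ('s, 'a) policy \<Rightarrow> 's set \<Rightarrow> real" where
  "reach_prob M \<sigma> T = measure (run_measure M \<sigma>) {\<omega>. \<exists>n. fst (\<omega> n) \<in> T}"

definition Up ::
  "('s::finite, 'a::finite, 'i::finite) memdp \<Rightarrow> 'i set \<Rightarrow> 's \<Rightarrow> 'a \<Rightarrow> 's \<Rightarrow> 'i set" where
  "Up N J s a s' = {i \<in> J. pmf (me_step N i s a) s' > 0}"

definition belief_mdp ::
  "('s::finite, 'a::finite, 'i::finite) memdp \<Rightarrow> ('s \<times> 'i \<times> 'i set, 'a, 's \<times> 'i set) obs_mdp" where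
  "belief_mdp N =
     \<lparr>init = map_pmf (\<lambda>(s, j). (s, j, UNIV)) (pair_pmf (me_init N) (pmf_of_set UNIV)),
      step = (\<lambda>(s, j, J) a. map_pmf (\<lambda>s'. (s', j, Up N J s a s')) (me_step N j s a)),
      obs = (\<lambda>(s, j, J). (s, J))\<rparr>"

definition obs_history ::
  "('s::finite, 'a::finite, 'z, 'm) obs_mdp_scheme \<Rightarrow> ('s, 'a) history \<Rightarrow> ('z, 'a) history" where
  "obs_history M = (\<lambda>(xs, x). (map (\<lambda>(y, a). (obs M y, a)) xs, obs M x))"

definition observation_based ::
  "('s::finite, 'a::finite, 'z, 'm) obs_mdp_scheme \<Rightarrow> ('s, 'a) policy \<Rightarrow> bool" where
  "observation_based M \<sigma> \<longleftrightarrow> (\<forall>\<pi> \<pi>'. obs_history M \<pi> = obs_history M \<pi>' \<longrightarrow> \<sigma> \<pi> = \<sigma> \<pi>')"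

definition belief_target :: "'s set \<Rightarrow> ('s \<times> 'i \<times> 'i set) set" where
  "belief_target T = {(s, j, J). s \<in> T \<and> j \<in> J}"


lemma pmf_init_belief_mdp:
  "pmf (init (belief_mdp N)) (s, j, J) =
     (if J = UNIV then pmf (me_init (N :: ('s::finite, 'a::finite, 'i::finite) memdp)) s
        / real (card (UNIV :: 'i set)) else 0)"
proof (cases "J = UNIV")
  case True
  have "inj (\<lambda>(s :: 's, j :: 'i). (s, j, UNIV :: 'i set))"
    by (auto simp: inj_def)
  from pmf_map_inj'[OF this, of "pair_pmf (me_init N) (pmf_of_set UNIV)" "(s, j)"] True
  show ?thesis
    by (simp add: belief_mdp_def pmf_pair)
next
  case False
  then show ?thesis
    by (auto simp: belief_mdp_def pmf_eq_0_set_pmf)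
qed

lemma pmf_step_belief_mdp:
  "pmf (step (belief_mdp N) (s, j, J) a) (s', j', J') =
     (if j' = j \<and> J' = Up N J s a s' then pmf (me_step N j s a) s' else 0)"
proof (cases "j' = j \<and> J' = Up N J s a s'")
  case True
  have "inj (\<lambda>s'. (s', j, Up N J s a s'))"
    by (auto simp: inj_def)
  from pmf_map_inj'[OF this, of "me_step N j s a" s'] True
  show ?thesis
    by (simp add: belief_mdp_def)
next
  case False
  then show ?thesis
    by (auto simp: belief_mdp_def pmf_eq_0_set_pmf)
qed

lemma measurable_prefix:
  "(\<lambda>\<omega>. map \<omega> [0..<n]) \<in> measurable (PiM {0..<n} (\<lambda>_. count_space (UNIV :: 'b::finite set)))
     (count_space UNIV)"
proof -
  let ?M = "PiM {0..<n} (\<lambda>_. count_space (UNIV :: 'b set))"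
  have "(\<lambda>\<omega>. map \<omega> [0..<k]) \<in> measurable ?M (count_space UNIV)" if "k \<le> n" for k
    using that
  proof (induction k)
    case (Suc k)
    have "(\<lambda>\<omega>. map \<omega> [0..<k]) \<in> measurable ?M (count_space UNIV)"
      using Suc by simp
    moreover have "(\<lambda>\<omega>. \<omega> k) \<in> measurable ?M (count_space UNIV)"
      using Suc.prems by (intro measurable_component_singleton) auto
    ultimately have "(\<lambda>\<omega>. (\<lambda>xs y. xs @ [y]) (map \<omega> [0..<k]) (\<omega> k)) \<in> measurable ?M (count_space UNIV)"
      by (rule measurable_compose_countable[OF measurable_compose[OF _ measurable_count_space], rotated])
    then show ?case by simp
  qed simp
  then show ?thesis by simp
qed

lemma next_pair_prefix:
  "next_pair M \<sigma> n \<omega> = next_pair M \<sigma> n (\<lambda>k. map \<omega> [0..<n] ! k)"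
proof -
  have "map (\<lambda>k. map \<omega> [0..<n] ! k) [0..<n] = map \<omega> [0..<n]"
    by (rule nth_equalityI) auto
  moreover have "next_state M n (\<lambda>k. map \<omega> [0..<n] ! k) = next_state M n \<omega>"
    by (cases n) (auto simp: next_state_def nth_append)
  ultimately show ?thesis
    by (simp only: next_pair_def)
qed

lemma Ionescu_Tulcea_next_pair:
  "Ionescu_Tulcea (\<lambda>n \<omega>. measure_pmf (next_pair M \<sigma> n \<omega>)) (\<lambda>_. count_space UNIV)"
proof
  fix n
  have "(\<lambda>xs. measure_pmf (next_pair M \<sigma> n (\<lambda>k. xs ! k)))
      \<in> measurable (count_space UNIV) (subprob_algebra (count_space UNIV))"
    by (auto simp: space_subprob_algebra intro!: measure_pmf.subprob_space_axioms)
  from measurable_compose[OF measurable_prefix[of n] this]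
  have "(\<lambda>\<omega>. measure_pmf (next_pair M \<sigma> n (\<lambda>k. map \<omega> [0..<n] ! k)))
      \<in> measurable (PiM {0..<n} (\<lambda>_. count_space UNIV)) (subprob_algebra (count_space UNIV))" .
  moreover have "(\<lambda>\<omega>. measure_pmf (next_pair M \<sigma> n \<omega>)) =
      (\<lambda>\<omega>. measure_pmf (next_pair M \<sigma> n (\<lambda>k. map \<omega> [0..<n] ! k)))"
    by (intro ext arg_cong[of _ _ measure_pmf] next_pair_prefix)
  ultimately show "(\<lambda>\<omega>. measure_pmf (next_pair M \<sigma> n \<omega>))
      \<in> measurable (PiM {0..<n} (\<lambda>_. count_space UNIV)) (subprob_algebra (count_space UNIV))"
    by (simp only:)
qed

lemma sets_run_measure: "sets (run_measure M \<sigma>) = sets (PiM UNIV (\<lambda>_. count_space UNIV))"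
proof -
  interpret Ionescu_Tulcea "\<lambda>n \<omega>. measure_pmf (next_pair M \<sigma> n \<omega>)" "\<lambda>_. count_space UNIV"
    by (rule Ionescu_Tulcea_next_pair)
  show ?thesis
    unfolding run_measure_def by (rule PF.sets_lim)
qed

lemma reach_event_in_sets: "{\<omega>. \<exists>n. fst (\<omega> n) \<in> T} \<in> sets (run_measure M \<sigma>)"
proof -
  have [measurable]: "(\<lambda>\<omega>. \<omega> n) \<in> measurable (run_measure M \<sigma>) (count_space UNIV)" for n
    by (subst measurable_cong_sets[OF sets_run_measure refl])
       (rule measurable_component_singleton, simp)
  have "{\<omega> \<in> space (run_measure M \<sigma>). \<exists>n. fst (\<omega> n) \<in> T} \<in> sets (run_measure M \<sigma>)"
    by measurable
  then show ?thesis
    by (simp add: sets_eq_imp_space_eq[OF sets_run_measure] space_PiM)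
qed

lemma distr_run_measure:
  assumes "finite J"
  shows "distr (run_measure M \<sigma>) (PiM J (\<lambda>_. count_space UNIV)) (\<lambda>\<omega>. restrict \<omega> J) =
    Ionescu_Tulcea.CI (\<lambda>n \<omega>. measure_pmf (next_pair M \<sigma> n \<omega>)) (\<lambda>_. count_space UNIV) J"
proof -
  interpret Ionescu_Tulcea "\<lambda>n \<omega>. measure_pmf (next_pair M \<sigma> n \<omega>)" "\<lambda>_. count_space UNIV"
    by (rule Ionescu_Tulcea_next_pair)
  show ?thesis
    unfolding run_measure_def by (rule distr_lim[OF assms])
qed

end

theory Submission
  imports Defs
begin

text \<open>
  A history of \<open>N\<close> determines the beliefs along it, so each environment \<open>i\<close> embeds the histories of \<open>N\<close>
  into those of the belief-observation MDP, and the observations of the embedded history do not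
  depend on \<open>i\<close>. Observation-based policies therefore correspond to policies of \<open>N\<close>. Under
  corresponding policies the law of the first \<open>n\<close> steps in the belief-observation MDP is the
  uniform mixture over \<open>i\<close> of the embedded laws in the environments; hence its reachability
  probability is the average of those of the environments, and it is 1 iff all of them are 1.
\<close>

section \<open>Laws of finite prefixes of runs\<close>

text \<open>\<open>nth xs\<close> stands in for a run: \<open>next_pair\<close> at \<open>n\<close>
  looks only below \<open>n\<close>, so the values of \<open>nth\<close> beyond the end of the list
  do not matter.\<close>

primrec prefix_law ::
  "('s::finite, 'a::finite, 'm) mdp_scheme \<Rightarrow> ('s, 'a) policy \<Rightarrow> nat \<Rightarrow> ('s \<times> 'a) list pmf" where
  "prefix_law M \<sigma> 0 = return_pmf []"
| "prefix_law M \<sigma> (Suc n) =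
     bind_pmf (prefix_law M \<sigma> n) (\<lambda>xs. map_pmf (\<lambda>p. xs @ [p]) (next_pair M \<sigma> n (nth xs)))"

lemma length_prefix_law: "xs \<in> set_pmf (prefix_law M \<sigma> n) \<Longrightarrow> length xs = n"
  by (induction n arbitrary: xs) auto

lemma next_pair_nth:
  assumes "length xs = n"
  shows "next_pair M \<sigma> n (nth xs) = bind_pmf (next_state M n (nth xs)) (\<lambda>s. map_pmf (Pair s) (\<sigma> (xs, s)))"
  using assms by (auto simp: next_pair_def map_nth)

lemma next_state_0: "next_state M 0 \<omega> = init M"
  by (simp add: next_state_def)

lemma next_state_snoc: "length zs = n \<Longrightarrow> next_state M (Suc n) (nth (zs @ [(t, a)])) = step M t a"
  by (auto simp: next_state_def nth_append)

text \<open>Transfers questions about the run measure to pmfs on lists. Both sides grow by one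
  kernel per step: the Ionescu-Tulcea composition \<open>C 0 n\<close> and the recursion of
  \<open>prefix_law\<close>.\<close>

lemma distr_run_measure_prefix:
  "distr (run_measure M \<sigma>) (count_space UNIV) (\<lambda>\<omega>. map \<omega> [0..<n]) = measure_pmf (prefix_law M \<sigma> n)"
proof -
  interpret Ionescu_Tulcea "\<lambda>n \<omega>. measure_pmf (next_pair M \<sigma> n \<omega>)" "\<lambda>_. count_space UNIV"
    by (rule Ionescu_Tulcea_next_pair)
  let ?P = "\<lambda>J. PiM J (\<lambda>_. count_space (UNIV :: ('a \<times> 'b) set))"
  let ?m = "\<lambda>n (\<omega> :: nat \<Rightarrow> 'a \<times> 'b). map \<omega> [0..<n]"
  \<comment> \<open>On an initial segment of indices the marginal is the composed kernel itself,
    since the cylinder embedding is then the identity. The constant \<open>undefined\<close> is the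
    only point of the empty product.\<close>
  have CI_C: "CI {0..<n} = C 0 n (\<lambda>_. undefined)" for n
  proof (rule measure_eqI)
    show "sets (CI {0..<n}) = sets (C 0 n (\<lambda>_. undefined))"
      by (simp add: sets_C PF.sets_P)
    fix X assume "X \<in> sets (CI {0..<n})"
    then have "X \<in> sets (?P {0..<n})"
      by (simp add: PF.sets_P)
    then show "emeasure (CI {0..<n}) X = emeasure (C 0 n (\<lambda>_. undefined)) X"
      by (subst emeasure_CI[of "{0..<n}" n]) (auto dest!: sets.sets_into_space simp: space_PiM prod_emb_id)
  qed
  have C: "distr (C 0 n (\<lambda>_. undefined)) (count_space UNIV) (?m n) = measure_pmf (prefix_law M \<sigma> n)" for n
  proof (induction n)
    case 0
    have "?m 0 \<in> ?P {0..<0} \<rightarrow>\<^sub>M count_space UNIV"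
      by (rule measurable_prefix)
    then show ?case
      by (subst C.simps, subst distr_return) (auto simp: return_pmf.rep_eq space_PiM)
  next
    case (Suc n)
    let ?C = "C 0 n (\<lambda>_. undefined)"
    let ?K = "\<lambda>xs. map_pmf (\<lambda>p. xs @ [p]) (next_pair M \<sigma> n (nth xs))"
    have sets: "sets ?C = sets (?P {0..<n})"
      using sets_C[of "\<lambda>_. undefined" 0 n] by simp
    have space: "space ?C = space (?P {0..<n})"
      using sets by (rule sets_eq_imp_space_eq)
    have ne: "space ?C \<noteq> {}"
      by (rule prob_space.not_empty[OF prob_space_C]) simp
    have "distr (C 0 (Suc n) (\<lambda>_. undefined)) (count_space UNIV) (?m (Suc n)) =
        ?C \<bind> (\<lambda>\<omega>. distr (eP n \<omega>) (count_space UNIV) (?m (Suc n)))"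
      unfolding C.simps add_0_left
    proof (rule distr_bind[OF _ ne measurable_prefix])
      show "eP n \<in> ?C \<rightarrow>\<^sub>M subprob_algebra (?P {0..<Suc n})"
        using measurable_eP by (simp add: measurable_cong_sets[OF sets refl])
    qed
    \<comment> \<open>By \<open>next_pair_prefix\<close> the kernel sees \<open>\<omega>\<close>
      only through its list, so the bind over functions factors through the push-forward to
      lists.\<close>
    also have "\<dots> = ?C \<bind> (\<lambda>\<omega>. measure_pmf (?K (?m n \<omega>)))"
    proof (rule bind_cong[OF refl])
      fix \<omega> assume "\<omega> \<in> space ?C"
      then have \<omega>: "\<omega> \<in> space (?P {0..<n})" by (simp add: space)
      have upd: "?m (Suc n) (fun_upd \<omega> n x) = ?m n \<omega> @ [x]" for x
        by simp
      have upd_measurable: "fun_upd \<omega> n \<in> measure_pmf (next_pair M \<sigma> n \<omega>) \<rightarrow>\<^sub>M ?P {0..<Suc n}"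
        using \<omega> by (auto simp: space_PiM PiE_iff extensional_def)
      have "distr (eP n \<omega>) (count_space UNIV) (?m (Suc n)) =
          distr (measure_pmf (next_pair M \<sigma> n \<omega>)) (count_space UNIV) (\<lambda>x. ?m n \<omega> @ [x])"
        unfolding eP_def by (subst distr_distr[OF measurable_prefix upd_measurable]) (simp add: comp_def upd)
      also have "\<dots> = measure_pmf (?K (?m n \<omega>))"
        by (subst next_pair_prefix) (simp add: map_pmf_rep_eq)
      finally show "distr (eP n \<omega>) (count_space UNIV) (?m (Suc n)) = measure_pmf (?K (?m n \<omega>))" .
    qed
    also have "\<dots> = distr ?C (count_space UNIV) (?m n) \<bind> (\<lambda>xs. measure_pmf (?K xs))"
    proof (rule bind_distr[symmetric, OF _ _ ne])
      show "?m n \<in> ?C \<rightarrow>\<^sub>M count_space UNIV"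
        using measurable_prefix[of n] by (simp add: measurable_cong_sets[OF sets refl])
      show "(\<lambda>xs. measure_pmf (?K xs)) \<in> count_space UNIV \<rightarrow>\<^sub>M subprob_algebra (count_space UNIV)"
        by (auto simp: space_subprob_algebra intro!: measure_pmf.subprob_space_axioms)
    qed
    also have "\<dots> = measure_pmf (prefix_law M \<sigma> (Suc n))"
      by (simp add: Suc.IH measure_pmf_bind)
    finally show ?case .
  qed
  have restrict: "(\<lambda>\<omega>. restrict \<omega> {0..<n}) \<in> run_measure M \<sigma> \<rightarrow>\<^sub>M ?P {0..<n}"
    by (subst measurable_cong_sets[OF sets_run_measure refl]) (rule measurable_restrict_subset, simp)
  \<comment> \<open>The list reads only coordinates below \<open>n\<close>, so the run measure can
    be replaced by its marginal on \<open>{0..<n}\<close>.\<close>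
  have "distr (run_measure M \<sigma>) (count_space UNIV) (?m n) =
      distr (run_measure M \<sigma>) (count_space UNIV) (?m n \<circ> (\<lambda>\<omega>. restrict \<omega> {0..<n}))"
    by (intro arg_cong[where f = "distr _ _"]) (auto simp: fun_eq_iff)
  also have "\<dots> = distr (C 0 n (\<lambda>_. undefined)) (count_space UNIV) (?m n)"
    by (subst distr_distr[OF measurable_prefix restrict, symmetric])
       (simp add: distr_run_measure CI_C)
  finally show ?thesis
    by (simp add: C)
qed

lemma measurable_run_prefix:
  "(\<lambda>\<omega>. map \<omega> [0..<n]) \<in> run_measure M \<sigma> \<rightarrow>\<^sub>M count_space UNIV"
proof -
  have "(\<lambda>\<omega>. restrict \<omega> {0..<n}) \<in> run_measure M \<sigma> \<rightarrow>\<^sub>M PiM {0..<n} (\<lambda>_. count_space UNIV)"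
    by (subst measurable_cong_sets[OF sets_run_measure refl]) (rule measurable_restrict_subset, simp)
  from measurable_compose[OF this measurable_prefix] show ?thesis
    by (rule measurable_cong[THEN iffD1, rotated]) auto
qed

text \<open>A push-forward has the same total mass, and the one to lists is a pmf.\<close>

lemma prob_space_run_measure: "prob_space (run_measure M \<sigma>)"
  by (rule prob_space_distrD[OF measurable_run_prefix[where n = 0]])
    (simp only: distr_run_measure_prefix[where n = 0] measure_pmf.prob_space_axioms)

lemma reach_prob_le_1: "reach_prob M \<sigma> T \<le> 1"
  unfolding reach_prob_def by (rule prob_space.prob_le_1[OF prob_space_run_measure])

text \<open>Continuity from below: reaching \<open>T\<close> is the increasing union of the events
  of hitting it within the first \<open>n\<close> pairs.\<close>

lemma LIMSEQ_reach_prob: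
  "(\<lambda>n. measure_pmf.prob (prefix_law M \<sigma> n) {xs. \<exists>p\<in>set xs. fst p \<in> T}) \<longlonglongrightarrow> reach_prob M \<sigma> T"
proof -
  interpret prob_space "run_measure M \<sigma>" by (rule prob_space_run_measure)
  let ?E = "\<lambda>n. {\<omega> :: nat \<Rightarrow> 'a \<times> 'b. \<exists>k<n. fst (\<omega> k) \<in> T}"
  have space: "space (run_measure M \<sigma>) = UNIV"
    by (simp add: sets_eq_imp_space_eq[OF sets_run_measure] space_PiM)
  have vimage: "(\<lambda>\<omega>. map \<omega> [0..<n]) -` {xs. \<exists>p\<in>set xs. fst p \<in> T} \<inter> space (run_measure M \<sigma>) = ?E n" for n
    by (auto simp: space)
  have sets: "?E n \<in> events" for n
    by (rule subst[OF vimage], rule measurable_sets[OF measurable_run_prefix]) simp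
  have "measure_pmf.prob (prefix_law M \<sigma> n) {xs. \<exists>p\<in>set xs. fst p \<in> T} = prob (?E n)" for n
    unfolding distr_run_measure_prefix[symmetric] by (subst measure_distr[OF measurable_run_prefix])
      (simp, simp only: vimage)
  moreover have "(\<lambda>n. prob (?E n)) \<longlonglongrightarrow> prob (\<Union>n. ?E n)"
  proof (rule finite_Lim_measure_incseq)
    show "range ?E \<subseteq> events"
      using sets by blast
    show "incseq ?E"
      by (rule incseq_SucI) (auto intro: less_SucI)
  qed
  moreover have "(\<Union>n. ?E n) = {\<omega>. \<exists>n. fst (\<omega> n) \<in> T}"
    by auto
  ultimately show ?thesis
    by (simp add: reach_prob_def)
qed

section \<open>Beliefs and the embedding of histories\<close>

text \<open>Closed form of what iterating \<open>Up\<close> from \<open>UNIV\<close> along a history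
  yields; \<open>belief_Nil\<close> and \<open>belief_snoc\<close> give the recursion.\<close>

definition belief ::
  "('s::finite, 'a::finite, 'i::finite) memdp \<Rightarrow> ('s, 'a) history \<Rightarrow> 'i set" where
  "belief N = (\<lambda>(xs, s). {i. \<forall>k<length xs.
     pmf (me_step N i (fst (xs ! k)) (snd (xs ! k))) ((map fst xs @ [s]) ! Suc k) > 0})"

lemma belief_Nil: "belief N ([], s) = UNIV"
  by (simp add: belief_def)

lemma belief_snoc: "belief N (zs @ [(t, a)], s) = Up N (belief N (zs, t)) t a s"
proof -
  \<comment> \<open>The index \<open>Suc k\<close> is at most \<open>length zs\<close>, where both
    lists hold \<open>t\<close>.\<close>
  have "(map fst (zs @ [(t, a)]) @ [s]) ! Suc k = (map fst zs @ [t]) ! Suc k" if "k < length zs" for k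
    using that by (auto simp: nth_append less_Suc_eq)
  then show ?thesis
    by (auto simp: belief_def Up_def nth_append less_Suc_eq)
qed

text \<open>The component \<open>i\<close> is constant because steps of \<open>belief_mdp\<close>
  keep the environment. Each belief uses only the history up to its state, so annotation commutes
  with extending the list.\<close>

definition annotate ::
  "('s::finite, 'a::finite, 'i::finite) memdp \<Rightarrow> 'i \<Rightarrow> ('s \<times> 'a) list \<Rightarrow> (('s \<times> 'i \<times> 'i set) \<times> 'a) list" where
  "annotate N i xs =
     map (\<lambda>k. ((fst (xs ! k), i, belief N (take k xs, fst (xs ! k))), snd (xs ! k))) [0..<length xs]"

definition annotate_history ::
  "('s::finite, 'a::finite, 'i::finite) memdp \<Rightarrow> 'i \<Rightarrow> ('s, 'a) history \<Rightarrow> ('s \<times> 'i \<times> 'i set, 'a) history" where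
  "annotate_history N i = (\<lambda>(xs, s). (annotate N i xs, (s, i, belief N (xs, s))))"

lemma length_annotate [simp]: "length (annotate N i xs) = length xs"
  by (simp add: annotate_def)

lemma annotate_Nil [simp]: "annotate N i [] = []"
  by (simp add: annotate_def)

lemma annotate_snoc [simp]:
  "annotate N i (xs @ [(s, a)]) = annotate N i xs @ [((s, i, belief N (xs, s)), a)]"
  by (auto simp: annotate_def nth_append)

text \<open>Beliefs are computed from the history alone, and \<open>obs\<close> erases the
  environment.\<close>

lemma obs_history_annotate:
  "obs_history (belief_mdp N) (annotate_history N i h) = obs_history (belief_mdp N) (annotate_history N j h)"
  by (auto simp: obs_history_def annotate_history_def annotate_def belief_mdp_def split: prod.split)

text \<open>The left inverse with which a policy of \<open>N\<close> is turned into an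
  observation-based one.\<close>

lemma forget_annotate:
  "map_prod (map (map_prod fst id)) fst (obs_history (belief_mdp N) (annotate_history N i h)) = h"
  by (cases h)
    (auto simp: obs_history_def annotate_history_def annotate_def belief_mdp_def intro!: nth_equalityI)

text \<open>The true environment gives positive probability to every transition it takes, so
  \<open>Up\<close> never removes it. The second claim at \<open>Suc n\<close> uses the first at
  \<open>n\<close>.\<close>

lemma env_in_belief:
  assumes "xs \<in> set_pmf (prefix_law (env N i) \<tau> n)"
  shows "s \<in> set_pmf (next_state (env N i) n (nth xs)) \<Longrightarrow> i \<in> belief N (xs, s)"
    and "p \<in> set (annotate N i xs) \<Longrightarrow> i \<in> snd (snd (fst p))"
  using assms
proof (induction n arbitrary: xs s p)
  case 0
  { case 1 then show ?case by (simp add: belief_Nil) }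
  { case 2 then show ?case by simp }
next
  case (Suc n)
  have *: "\<exists>zs t a. xs = zs @ [(t, a)] \<and> zs \<in> set_pmf (prefix_law (env N i) \<tau> n) \<and>
      t \<in> set_pmf (next_state (env N i) n (nth zs))"
    if "xs \<in> set_pmf (prefix_law (env N i) \<tau> (Suc n))" for xs
    using that by (fastforce simp: next_pair_def)
  { case 1
    with * obtain zs t a where xs: "xs = zs @ [(t, a)]" "zs \<in> set_pmf (prefix_law (env N i) \<tau> n)"
      "t \<in> set_pmf (next_state (env N i) n (nth zs))" by blast
    with Suc.IH(1) have "i \<in> belief N (zs, t)" by blast
    moreover have "s \<in> set_pmf (me_step N i t a)"
      using 1(1) unfolding xs(1) next_state_snoc[OF length_prefix_law[OF xs(2)]] by (simp add: env_def)
    ultimately show ?case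
      by (simp add: xs(1) belief_snoc Up_def pmf_positive) }
  { case 2
    with * obtain zs t a where xs: "xs = zs @ [(t, a)]" "zs \<in> set_pmf (prefix_law (env N i) \<tau> n)"
      "t \<in> set_pmf (next_state (env N i) n (nth zs))" by blast
    from 2(1) consider "p \<in> set (annotate N i zs)" | "p = ((t, i, belief N (zs, t)), a)"
      by (auto simp: xs(1))
    then show ?case
      using Suc.IH(1)[OF xs(3,2)] Suc.IH(2)[OF _ xs(2)] by cases auto }
qed

section \<open>The belief-observation MDP as a mixture of the environments\<close>

text \<open>
  The environment is drawn together with the initial state, so passing from length 0 to length 1
  differs from every other step; the induction therefore starts at length 1.
\<close>

lemma prefix_law_belief_mdp:
  fixes N :: "('s::finite, 'a::finite, 'i::finite) memdp"
  assumes \<sigma>: "\<And>i h. \<sigma> (annotate_history N i h) = \<tau> h"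
  shows "prefix_law (belief_mdp N) \<sigma> (Suc n) =
    bind_pmf (pmf_of_set UNIV) (\<lambda>i. map_pmf (annotate N i) (prefix_law (env N i) \<tau> (Suc n)))"
proof -
  have \<sigma>': "\<sigma> (annotate N i xs, (s, i, belief N (xs, s))) = \<tau> (xs, s)" for i xs s
    using \<sigma>[of i "(xs, s)"] by (simp add: annotate_history_def)
  show ?thesis
  proof (induction n)
    case 0
    \<comment> \<open>The initial state and the environment are independent, so the environment may
      be drawn first.\<close>
    have "init (belief_mdp N) =
        bind_pmf (pmf_of_set UNIV) (\<lambda>i. map_pmf (\<lambda>s. (s, i, UNIV)) (me_init N))"
      by (simp add: belief_mdp_def pair_pmf_def map_bind_pmf map_pmf_def bind_assoc_pmf bind_return_pmf)
        (rule bind_commute_pmf)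
    then show ?case
      using \<sigma>'[of _ "[]"]
      by (simp add: bind_return_pmf next_pair_nth next_state_0 env_def bind_assoc_pmf bind_map_pmf
          map_bind_pmf pmf.map_comp comp_def belief_Nil annotate_snoc[of _ _ "[]", simplified])
  next
    case (Suc n)
    \<comment> \<open>Extension by one pair commutes with annotation: the list is nonempty, so the
      next state comes from \<open>step\<close>, whose \<open>Up\<close> matches
      \<open>belief_snoc\<close>.\<close>
    have *: "map_pmf (\<lambda>p. annotate N i xs @ [p]) (next_pair (belief_mdp N) \<sigma> (Suc n) (nth (annotate N i xs))) =
        map_pmf (annotate N i) (map_pmf (\<lambda>p. xs @ [p]) (next_pair (env N i) \<tau> (Suc n) (nth xs)))"
      if "xs \<in> set_pmf (prefix_law (env N i) \<tau> (Suc n))" for i xs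
    proof -
      from length_prefix_law[OF that] obtain zs t a where xs: "xs = zs @ [(t, a)]" and len: "length zs = n"
        by (cases xs rule: rev_cases) auto
      have "next_state (belief_mdp N) (Suc n) (nth (annotate N i xs)) =
          map_pmf (\<lambda>s. (s, i, belief N (xs, s))) (next_state (env N i) (Suc n) (nth xs))"
        by (simp add: xs len next_state_snoc belief_snoc belief_mdp_def env_def)
      then show ?thesis
        by (simp add: xs len next_pair_nth \<sigma>' bind_map_pmf map_bind_pmf pmf.map_comp comp_def
            flip: annotate_snoc)
    qed
    show ?case
      unfolding prefix_law.simps(2)[of _ _ "Suc n"] Suc.IH bind_assoc_pmf bind_map_pmf map_bind_pmf
      by (intro bind_pmf_cong refl *)
  qed
qed

lemma reach_prob_belief_mdp:
  fixes N :: "('s::finite, 'a::finite, 'i::finite) memdp"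
  assumes "\<And>i h. \<sigma> (annotate_history N i h) = \<tau> h"
  shows "reach_prob (belief_mdp N) \<sigma> (belief_target T) =
    (\<Sum>i\<in>UNIV. reach_prob (env N i) \<tau> T) / card (UNIV :: 'i set)"
proof -
  let ?E = "\<lambda>T. {xs. \<exists>p\<in>set xs. fst p \<in> T}"
  let ?Q = "\<lambda>i n. measure_pmf.prob (prefix_law (env N i) \<tau> n) (?E T)"
  \<comment> \<open>Only on the support: a visit to \<open>T\<close> lifts to
    \<open>belief_target T\<close> only if \<open>i\<close> lies in the belief, which
    \<open>env_in_belief\<close> ensures.\<close>
  have hit: "annotate N i xs \<in> ?E (belief_target T) \<longleftrightarrow> xs \<in> ?E T"
    if "xs \<in> set_pmf (prefix_law (env N i) \<tau> n)" for i n xs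
  proof -
    note supp = that
    have "\<exists>p\<in>set (annotate N i xs). fst p \<in> belief_target T" if "k < length xs" "fst (xs ! k) \<in> T" for k
    proof -
      have mem: "annotate N i xs ! k \<in> set (annotate N i xs)" using that by simp
      moreover from env_in_belief(2)[OF supp mem] that
      have "fst (annotate N i xs ! k) \<in> belief_target T"
        by (simp add: annotate_def belief_target_def)
      ultimately show ?thesis by blast
    qed
    moreover have "\<exists>p\<in>set xs. fst p \<in> T" if "\<exists>p\<in>set (annotate N i xs). fst p \<in> belief_target T"
      using that by (auto simp: annotate_def belief_target_def)
    ultimately show ?thesis
      by (auto simp: in_set_conv_nth)
  qed
  have "measure_pmf.prob (prefix_law (belief_mdp N) \<sigma> (Suc n)) (?E (belief_target T)) =
      (\<Sum>i\<in>UNIV. ?Q i (Suc n)) / card (UNIV :: 'i set)" for n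
  proof -
    have "measure_pmf.prob (map_pmf (annotate N i) (prefix_law (env N i) \<tau> (Suc n))) (?E (belief_target T)) =
        ?Q i (Suc n)" for i
      unfolding measure_map_pmf
      by (rule measure_pmf.finite_measure_eq_AE) (unfold AE_measure_pmf_iff, use hit in blast, simp_all)
    then show ?thesis
      unfolding prefix_law_belief_mdp[of \<sigma> N \<tau>, OF assms] measure_pmf_bind
      by (subst measure_pmf.measure_bind[where N = "count_space UNIV"])
        (auto simp: integral_pmf_of_set space_subprob_algebra simp del: prefix_law.simps
          intro!: measure_pmf.subprob_space_axioms)
  qed
  \<comment> \<open>Limits are taken along \<open>Suc n\<close> because the mixture identity starts
    at length 1.\<close>
  moreover have "(\<lambda>n. (\<Sum>i\<in>UNIV. ?Q i (Suc n)) / card (UNIV :: 'i set)) \<longlonglongrightarrow>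
      (\<Sum>i\<in>UNIV. reach_prob (env N i) \<tau> T) / card (UNIV :: 'i set)"
    by (intro tendsto_intros LIMSEQ_Suc LIMSEQ_reach_prob) auto
  moreover note LIMSEQ_Suc[OF LIMSEQ_reach_prob[of "belief_mdp N" \<sigma> "belief_target T"]]
  ultimately show ?thesis
    by (auto intro: LIMSEQ_unique)
qed

text \<open>The deficits \<open>1 - reach_prob (env N i) \<tau> T\<close> are nonnegative, so their
  sum vanishes only if each does.\<close>

lemma reach_prob_belief_mdp_eq_1_iff:
  fixes N :: "('s::finite, 'a::finite, 'i::finite) memdp"
  assumes "\<And>i h. \<sigma> (annotate_history N i h) = \<tau> h"
  shows "reach_prob (belief_mdp N) \<sigma> (belief_target T) = 1 \<longleftrightarrow> (\<forall>i. reach_prob (env N i) \<tau> T = 1)"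
proof -
  have "reach_prob (belief_mdp N) \<sigma> (belief_target T) = 1 \<longleftrightarrow>
      (\<Sum>i\<in>UNIV. 1 - reach_prob (env N i) \<tau> T) = 0"
    unfolding reach_prob_belief_mdp[of \<sigma> N \<tau>, OF assms] by (auto simp: sum_subtractf field_simps)
  also have "\<dots> \<longleftrightarrow> (\<forall>i. reach_prob (env N i) \<tau> T = 1)"
    by (subst sum_nonneg_eq_0_iff) (auto simp: reach_prob_le_1)
  finally show ?thesis .
qed

theorem theorem1:
  fixes N :: "('s::finite, 'a::finite, 'i::finite) memdp" and T :: "'s set"
  shows "(\<exists>\<sigma> :: ('s, 'a) policy. \<forall>i :: 'i. reach_prob (env N i) \<sigma> T = 1) \<longleftrightarrow>
    (\<exists>\<sigma> :: ('s \<times> 'i \<times> 'i set, 'a) policy.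
       observation_based (belief_mdp N) \<sigma> \<and>
       reach_prob (belief_mdp N) \<sigma> (belief_target T) = 1)"
proof
  assume "\<exists>\<sigma> :: ('s, 'a) policy. \<forall>i :: 'i. reach_prob (env N i) \<sigma> T = 1"
  then obtain \<tau> :: "('s, 'a) policy" where \<tau>: "\<forall>i. reach_prob (env N i) \<tau> T = 1" by blast
  define \<sigma> where "\<sigma> \<pi> = \<tau> (map_prod (map (map_prod fst id)) fst (obs_history (belief_mdp N) \<pi>))" for \<pi>
  have "observation_based (belief_mdp N) \<sigma>"
    by (simp add: observation_based_def \<sigma>_def)
  moreover have "reach_prob (belief_mdp N) \<sigma> (belief_target T) = 1"
    using \<tau> by (subst reach_prob_belief_mdp_eq_1_iff[where \<tau> = \<tau>]) (simp_all add: \<sigma>_def forget_annotate)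
  ultimately show "\<exists>\<sigma> :: ('s \<times> 'i \<times> 'i set, 'a) policy. observation_based (belief_mdp N) \<sigma> \<and>
      reach_prob (belief_mdp N) \<sigma> (belief_target T) = 1" by blast
next
  assume "\<exists>\<sigma> :: ('s \<times> 'i \<times> 'i set, 'a) policy. observation_based (belief_mdp N) \<sigma> \<and>
      reach_prob (belief_mdp N) \<sigma> (belief_target T) = 1"
  then obtain \<sigma> :: "('s \<times> 'i \<times> 'i set, 'a) policy" where
    \<sigma>: "observation_based (belief_mdp N) \<sigma>" "reach_prob (belief_mdp N) \<sigma> (belief_target T) = 1" by blast
  \<comment> \<open>\<open>undefined\<close> is an arbitrary environment; being observation-based,
    \<open>\<sigma>\<close> induces the same policy of \<open>N\<close> through every
    embedding.\<close>
  have *: "\<sigma> (annotate_history N i h) = \<sigma> (annotate_history N undefined h)" for i h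
    using \<sigma>(1) obs_history_annotate unfolding observation_based_def by blast
  from \<sigma>(2) reach_prob_belief_mdp_eq_1_iff[of \<sigma> N "\<lambda>h. \<sigma> (annotate_history N undefined h)", OF *]
  show "\<exists>\<sigma> :: ('s, 'a) policy. \<forall>i :: 'i. reach_prob (env N i) \<sigma> T = 1" by blast
qed

end
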